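(* Let $G$ be a finite simple graph with minimum degree $\delta(G)\ge 1$ and let $n\ge 2$ be an integer. Then $\gamma_{tg}(G)=\gamma_{Zg}(G\circ \overline{K}_n)$, where $\overline{K}_n$ is the edgeless graph on $n$ vertices and $\circ$ denotes the lexicographic product.
   Context: Graphs are finite and simple. $N(v)$ and $N[v]=N(v)\cup\{v\}$ denote the open and closed neighborhood of a vertex $v$. The lexicographic product $G\circ H$ has vertex set $V(G)\times V(H)$; vertices $(g_1,h_1)$ and $(g_2,h_2)$ are adjacent if $g_1g_2\in E(G)$, or $g_1=g_2$ and $h_1h_2\in E(H)$. Games: two players, Dominator and Staller, alternately select vertices $v_1,v_2,\ldots$ of an isolate-free graph $G$. In the total domination game the $i$-th move $v_i$ is legal if $N(v_i)\setminus\bigcup_{j=1}^{i-1}N(v_j)\neq\emptyset$. In the Z-domination game the $i$-th move $v_i$ is legal if $N(v_i)\setminus\bigcup_{j=1}^{i-1}N[v_j]\neq\emptyset$. Each game ends when no legal move is available. Dominator wants to minimize the total number of moves, Staller wants to maximize it. When Dominator moves first and both players play optimally, the total number of moves played (by both players) is $\gamma_{tg}(G)$ for the total domination game and $\gamma_{Zg}(G)$ for the Z-domination game. *)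

theory Defs
  imports "Graph_Theory.Pair_Digraph" "HOL-Library.Extended_Nat"
begin

text \<open>
  A finite simple graph is a \<^term>\<open>pair_graph\<close>: a finite, loop-free pair digraph whose
  arc relation is symmetric, so that the edge \<open>uv\<close> is the pair of arcs \<open>(u, v)\<close>, \<open>(v, u)\<close>.
\<close>

definition nbhd :: "'a pair_pre_digraph \<Rightarrow> 'a \<Rightarrow> 'a set" where
  "nbhd G v = {u. (v, u) \<in> parcs G}"

definition closed_nbhd :: "'a pair_pre_digraph \<Rightarrow> 'a \<Rightarrow> 'a set" where
  "closed_nbhd G v = insert v (nbhd G v)"

text \<open>
  With values in \<^typ>\<open>enat\<close> the minimum degree of the graph without vertices is \<open>\<infinity>\<close>;
  for every other finite graph this is the least of the vertex degrees.
\<close>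

definition min_degree :: "'a pair_pre_digraph \<Rightarrow> enat" where
  "min_degree G = (INF v\<in>pverts G. enat (card (nbhd G v)))"

definition lex_product ::
    "'a pair_pre_digraph \<Rightarrow> 'b pair_pre_digraph \<Rightarrow> ('a \<times> 'b) pair_pre_digraph" where
  "lex_product G H =
    \<lparr> pverts = pverts G \<times> pverts H,
      parcs = {((g1, h1), (g2, h2)) | g1 h1 g2 h2.
        (g1, h1) \<in> pverts G \<times> pverts H \<and> (g2, h2) \<in> pverts G \<times> pverts H \<and>
        ((g1, g2) \<in> parcs G \<or> g1 = g2 \<and> (h1, h2) \<in> parcs H)} \<rparr>"

definition edgeless :: "nat \<Rightarrow> nat pair_pre_digraph" where
  "edgeless n = \<lparr> pverts = {..<n}, parcs = {} \<rparr>"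

lemma pair_graph_lex_product:
  assumes "pair_graph G" "pair_graph H"
  shows "pair_graph (lex_product G H)"
proof -
  interpret G: pair_graph G by fact
  interpret H: pair_graph H by fact
  show ?thesis
  proof
    show "finite (pverts (lex_product G H))"
      by (simp add: lex_product_def)
    show "finite (parcs (lex_product G H))"
      by (rule finite_subset[of _ "(pverts G \<times> pverts H) \<times> (pverts G \<times> pverts H)"])
        (auto simp: lex_product_def)
    show "symmetric (with_proj (lex_product G H))"
      using G.pair_sym_arcs H.pair_sym_arcs
      by (auto simp: lex_product_def symmetric_def sym_def)
  qed (auto simp: lex_product_def dest: G.pair_no_loops H.pair_no_loops)
qed

lemma pair_graph_edgeless: "pair_graph (edgeless n)"
  by unfold_locales (auto simp: edgeless_def symmetric_def sym_def)

datatype game = Total | Z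

datatype player = Dominator | Staller

fun opponent :: "player \<Rightarrow> player" where
  "opponent Dominator = Staller"
| "opponent Staller = Dominator"

fun covered_by :: "game \<Rightarrow> 'a pair_pre_digraph \<Rightarrow> 'a \<Rightarrow> 'a set" where
  "covered_by Total G v = nbhd G v"
| "covered_by Z G v = closed_nbhd G v"

text \<open>
  In both games a move \<open>v\<close> is judged by the open neighbourhood of \<open>v\<close>; the games differ only
  in what the earlier moves \<open>vs\<close> have covered.
\<close>

definition legal_moves :: "game \<Rightarrow> 'a pair_pre_digraph \<Rightarrow> 'a list \<Rightarrow> 'a set" where
  "legal_moves t G vs = {v \<in> pverts G. nbhd G v - (\<Union>u\<in>set vs. covered_by t G u) \<noteq> {}}"

lemma legal_moves_not_played: "v \<in> legal_moves t G vs \<Longrightarrow> v \<in> pverts G - set vs"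
  by (cases t) (auto simp: legal_moves_def closed_nbhd_def)

text \<open>
  The number of moves still to be made under optimal play when the moves \<open>vs\<close> (latest first)
  have been made and \<open>p\<close> is to move. The finiteness test only serves to make the recursion
  terminate on all arguments; the value for infinite vertex sets is a dummy.
\<close>

function moves_left :: "game \<Rightarrow> 'a pair_pre_digraph \<Rightarrow> player \<Rightarrow> 'a list \<Rightarrow> nat" where
  "moves_left t G p vs =
    (if infinite (pverts G) \<or> legal_moves t G vs = {} then 0
     else case p of
       Dominator \<Rightarrow> Suc (MIN v\<in>legal_moves t G vs. moves_left t G (opponent p) (v # vs))
     | Staller \<Rightarrow> Suc (MAX v\<in>legal_moves t G vs. moves_left t G (opponent p) (v # vs)))"
  by pat_completeness auto
termination
  by (relation "measure (\<lambda>(t, G, p, vs). card (pverts G - set vs))")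
    (auto dest!: legal_moves_not_played intro!: psubset_card_mono)

declare moves_left.simps [simp del]

definition gamma_tg :: "'a pair_pre_digraph \<Rightarrow> nat" where
  "gamma_tg G = moves_left Total G Dominator []"

definition gamma_Zg :: "'a pair_pre_digraph \<Rightarrow> nat" where
  "gamma_Zg G = moves_left Z G Dominator []"

end

theory Submission
  imports Defs
begin

text \<open>
  In the product all vertices of a fibre \<open>{g} \<times> {..<n}\<close> have the same open neighbourhood, so once
  one of them has been played the others are illegal. Hence at most one vertex of a fibre is ever
  covered merely by having been played itself, and, as \<open>n \<ge> 2\<close>, another vertex of that fibre
  remains uncovered until a neighbour of \<open>g\<close> is played. Therefore \<open>(g, h)\<close> is legal in the
  Z-domination game exactly if \<open>g\<close> is legal in the total domination game after the projected moves.
\<close>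

lemma nbhd_lex_product_edgeless:
  assumes "pair_wf_digraph G"
  shows "nbhd (lex_product G (edgeless n)) (g, h) = (if h < n then nbhd G g \<times> {..<n} else {})"
  using pair_wf_digraph.in_arcsD1[OF assms] pair_wf_digraph.in_arcsD2[OF assms]
  by (auto simp: nbhd_def lex_product_def edgeless_def)

text \<open>The hypothesis \<open>distinct (map fst vs)\<close> says that no fibre has been played
  twice, so one of the two vertices \<open>(u, 0)\<close> and \<open>(u, 1)\<close> is still
  unplayed.\<close>

lemma ex_uncovered_in_fibre:
  fixes n :: nat
  assumes "n \<ge> 2" and "distinct (map fst vs)"
  obtains h where "h < n" and "(u, h) \<notin> set vs"
proof -
  have "\<not> ((u, 0) \<in> set vs \<and> (u, 1) \<in> set vs)"
    using assms(2) inj_onD[of fst "set vs" "(u, 0)" "(u, 1)"] by (auto simp: distinct_map)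
  moreover have "0 < n" "1 < n"
    using assms(1) by auto
  ultimately show ?thesis
    using that by blast
qed

lemma legal_moves_lex_product_edgeless:
  assumes "pair_wf_digraph G" and "n \<ge> 2"
    and "distinct (map fst vs)" and "set vs \<subseteq> pverts G \<times> {..<n}"
  shows "legal_moves Z (lex_product G (edgeless n)) vs =
    legal_moves Total G (map fst vs) \<times> {..<n}"
proof -
  let ?L = "lex_product G (edgeless n)"
  note nbhd = nbhd_lex_product_edgeless[OF assms(1)]
  have verts: "pverts ?L = pverts G \<times> {..<n}"
    by (simp add: lex_product_def edgeless_def)
  \<comment> \<open>The summand \<open>set vs\<close> is all that closed neighbourhoods add to the
    coverage of the total domination game, lifted to whole fibres.\<close>
  have union: "(\<Union>w\<in>set vs. closed_nbhd ?L w) =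
      set vs \<union> (\<Union>g\<in>fst ` set vs. nbhd G g) \<times> {..<n}"
    using assms(4) by (fastforce simp: closed_nbhd_def nbhd)
  have uncovered: "nbhd G g \<times> {..<n} - (set vs \<union> D \<times> {..<n}) \<noteq> {} \<longleftrightarrow> nbhd G g - D \<noteq> {}" for g D
  proof
    assume "nbhd G g - D \<noteq> {}"
    then obtain u where u: "u \<in> nbhd G g" "u \<notin> D"
      by blast
    obtain h where "h < n" "(u, h) \<notin> set vs"
      using ex_uncovered_in_fibre[OF assms(2,3)] .
    with u show "nbhd G g \<times> {..<n} - (set vs \<union> D \<times> {..<n}) \<noteq> {}"
      by blast
  qed blast
  have "(g, h) \<in> legal_moves Z ?L vs \<longleftrightarrow> g \<in> legal_moves Total G (map fst vs) \<and> h < n" for g h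
    using uncovered[of g "\<Union>g\<in>fst ` set vs. nbhd G g"]
    by (cases "h < n") (simp_all add: legal_moves_def verts nbhd union del: Diff_eq_empty_iff)
  then show ?thesis
    by auto
qed

text \<open>Induction along the game tree; the two conditions on \<open>vs\<close> are an invariant
  of legal play.\<close>

lemma moves_left_lex_product_edgeless:
  assumes "pair_graph G" and "n \<ge> 2"
    and "distinct (map fst vs)" and "set vs \<subseteq> pverts G \<times> {..<n}"
  shows "moves_left Z (lex_product G (edgeless n)) p vs = moves_left Total G p (map fst vs)"
  using assms(3,4)
proof (induction Z "lex_product G (edgeless n)" p vs rule: moves_left.induct)
  case (1 p vs)
  let ?L = "lex_product G (edgeless n)"
  let ?A = "legal_moves Total G (map fst vs)"
  interpret pair_graph G by fact
  have fin: "finite (pverts ?L)"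
    by (simp add: lex_product_def edgeless_def)
  have legal: "legal_moves Z ?L vs = ?A \<times> {..<n}"
    using legal_moves_lex_product_edgeless[OF _ assms(2) 1(3,4)] pair_wf_digraph_axioms by blast
  show ?case
  proof (cases "?A = {}")
    case True
    then show ?thesis
      by (simp add: moves_left.simps[of _ _ p] legal)
  next
    case False
    have nonempty: "legal_moves Z ?L vs \<noteq> {}"
      using False assms(2) by (auto simp: legal lessThan_empty_iff)
    have IH: "moves_left Z ?L (opponent p) (v # vs) =
        moves_left Total G (opponent p) (fst v # map fst vs)" if v: "v \<in> ?A \<times> {..<n}" for v
    proof -
      \<comment> \<open>A vertex legal in the total domination game is unplayed there, so
        \<open>v\<close> opens a new fibre and the invariant survives.\<close>
      have "fst v \<in> pverts G - set (map fst vs)"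
        using v by (intro legal_moves_not_played) auto
      then have "distinct (map fst (v # vs))" "set (v # vs) \<subseteq> pverts G \<times> {..<n}"
        using v 1(3,4) by auto
      then show ?thesis
        using 1(1,2)[of v] v fin nonempty legal by (cases p) auto
    qed
    \<comment> \<open>Minimum and maximum depend only on the set of values, so the \<open>n\<close>
      copies of each move of \<open>G\<close> count as one.\<close>
    have "(\<lambda>v. moves_left Z ?L (opponent p) (v # vs)) ` legal_moves Z ?L vs =
        (\<lambda>g. moves_left Total G (opponent p) (g # map fst vs)) ` fst ` (?A \<times> {..<n})"
      unfolding image_image legal by (rule image_cong[OF refl IH])
    also have "fst ` (?A \<times> {..<n}) = ?A"
      using assms(2) by (simp add: lessThan_empty_iff)
    finally show ?thesis
      unfolding moves_left.simps[of _ _ p] using fin nonempty False by (cases p) auto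
  qed
qed

theorem theorem3p1:
  fixes G :: "'a pair_pre_digraph" and n :: nat
  assumes "pair_graph G"
    and "min_degree G \<ge> 1"
    and "n \<ge> 2"
  shows "gamma_tg G = gamma_Zg (lex_product G (edgeless n))"
  using moves_left_lex_product_edgeless[OF assms(1,3), of "[]"]
  by (simp add: gamma_tg_def gamma_Zg_def)

end
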